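(* Let $n\in\mathbb{N}$. The coefficients of $p_n(x)$ satisfy $c_{n,2^{n+1}}=1$ and, for every $j\in\{1,2,\dots,2^n\}$, $$c_{n,2(2^n-j)}=-\sum_{i=2^n-j+1}^{2^n}\binom{2i}{j+i-2^n}\,c_{n,2i}.$$ (Thus the coefficients $c_{n,2(2^n-j)}$ are determined recursively in $j$ from $0$ to $2^n$.)
   Context: The polynomials $p_n(x)\in\mathbb{Z}[x]$ are defined by $p_0(x)=x^2-2$ and $p_n(x)=p_{n-1}(x)^2-2$ for $n\ge1$. For $n,k\in\mathbb{N}$, $c_{n,k}$ denotes the coefficient of $x^k$ in $p_n(x)$. *)

theory Defs
  imports "HOL-Computational_Algebra.Polynomial"
begin

fun p :: "nat \<Rightarrow> int poly" where
  "p 0 = [:-2, 0, 1:]"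
| "p (Suc n) = (p n)\<^sup>2 - [:2:]"

definition c :: "nat \<Rightarrow> nat \<Rightarrow> int" where
  "c n k = coeff (p n) k"

end

theory Submission
  imports Defs
begin

text \<open>Write \<open>p n\<close> as a polynomial \<open>q n\<close> in \<open>x\<^sup>2\<close>. From \<open>(t + 1/t)\<^sup>2 - 2 = t\<^sup>2 + 1/t\<^sup>2\<close> one gets
  that \<open>p n\<close> takes the value \<open>t^(2N) + t^(-2N)\<close> at \<open>t + 1/t\<close>, where \<open>N = 2^n\<close>. Substituting
  \<open>u = t\<^sup>2\<close> and clearing denominators, \<open>\<Sum>i\<le>N. c n (2i) u^(N-i) (1+u)^(2i) = u^(2N) + 1\<close>.
  Comparing the coefficients of \<open>u^j\<close> for \<open>0 \<le> j \<le> N\<close> gives the recursion.\<close>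

fun q :: "nat \<Rightarrow> 'a::comm_ring_1 poly" where
  "q 0 = [:-2, 1:]"
| "q (Suc n) = (q n)\<^sup>2 - [:2:]"

text \<open>Carries the identity back to integer coefficients from a field, where division by
  \<open>u\<close> is available.\<close>

lemma coeff_q_of_int: "coeff (q n :: 'a::comm_ring_1 poly) i = of_int (coeff (q n) i)"
proof (induction n arbitrary: i)
  case 0
  then show ?case by (simp add: coeff_pCons split: nat.split)
next
  case (Suc n)
  then show ?case
    by (simp add: power2_eq_square coeff_mult coeff_pCons split: nat.split)
qed

lemma p_eq_q_square: "p n = pcompose (q n) [:0, 0, 1:]"
  by (induction n) (simp_all add: pcompose_diff pcompose_pCons power2_eq_square pcompose_mult)

lemma coeff_pcompose_square:
  fixes r :: "'a::comm_semiring_1 poly"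
  shows "coeff (pcompose r [:0, 0, 1:]) (2 * i) = coeff r i"
proof (induction r arbitrary: i)
  case (pCons a r)
  then show ?case
    by (cases i) (simp_all add: pcompose_pCons)
qed simp

lemma c_even: "c n (2 * i) = coeff (q n) i"
  by (simp add: c_def p_eq_q_square coeff_pcompose_square)

lemma degree_q_le: "degree (q n :: 'a::comm_ring_1 poly) \<le> 2 ^ n"
proof (induction n)
  case (Suc n)
  have "degree ((q n :: 'a poly)\<^sup>2) \<le> 2 ^ Suc n"
    using degree_power_le[of "q n :: 'a poly" 2] Suc by simp
  then show ?case
    by (simp add: degree_diff_le)
qed simp

text \<open>Since (1+u)^2/u = u + 1/u + 2, \<open>q 0\<close> takes the value u + 1/u there, and
  each recursion step squares both summands. Working with u rather than t avoids square
  roots.\<close>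

lemma poly_q:
  fixes u :: "'a::field"
  assumes "u \<noteq> 0"
  shows "poly (q n) ((1 + u)\<^sup>2 / u) = u ^ 2 ^ n + 1 / u ^ 2 ^ n"
proof (induction n)
  case 0
  show ?case
    using assms by (simp add: field_simps power2_eq_square)
next
  case (Suc n)
  have "poly (q (Suc n)) ((1 + u)\<^sup>2 / u) = (u ^ 2 ^ n + 1 / u ^ 2 ^ n)\<^sup>2 - 2"
    using Suc by simp
  also have "\<dots> = u ^ 2 ^ Suc n + 1 / u ^ 2 ^ Suc n"
    using assms by (simp add: power2_sum power_divide mult.commute flip: power_mult)
  finally show ?case .
qed

lemma coeff_one_plus_X_power: "coeff ([:1, 1:] ^ m) k = (of_nat (m choose k) :: 'a::comm_ring_1)"
proof (cases "k \<le> m")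
  case True
  then show ?thesis using coeff_linear_poly_power[of k m 1 1] by simp
next
  case False
  have "degree ([:1, 1::'a:] ^ m) \<le> m" using degree_power_le[of "[:1, 1::'a:]" m] by simp
  then show ?thesis using False by (simp add: coeff_eq_0 binomial_eq_0)
qed

lemma q_homogenized:
  "(\<Sum>i\<le>2 ^ n. monom (coeff (q n) i) (2 ^ n - i) * [:1, 1:] ^ (2 * i))
    = monom 1 (2 * 2 ^ n) + (1 :: 'a::field_char_0 poly)" (is "?L = ?R")
proof -
  let ?N = "2 ^ n :: nat"
  have "poly ?L u = poly ?R u" if "u \<noteq> 0" for u
  proof -
    have "poly ?L u = (\<Sum>i\<le>?N. u ^ ?N * (coeff (q n) i * ((1 + u)\<^sup>2 / u) ^ i))"
      unfolding poly_sum
    proof (rule sum.cong)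
      fix i assume "i \<in> {..?N}"
      then have "u ^ ?N = u ^ (?N - i) * u ^ i"
        by (simp flip: power_add)
      then show "poly (monom (coeff (q n) i) (?N - i) * [:1, 1:] ^ (2 * i)) u
          = u ^ ?N * (coeff (q n) i * ((1 + u)\<^sup>2 / u) ^ i)"
        using that by (simp add: poly_monom power_divide flip: power_mult)
    qed simp
    \<comment> \<open>\<open>poly_altdef\<close> sums up to the degree; \<open>degree_q_le\<close>
      makes any further terms up to \<open>?N\<close> zero.\<close>
    also have "\<dots> = u ^ ?N * poly (q n) ((1 + u)\<^sup>2 / u)"
      unfolding poly_altdef sum_distrib_left[symmetric] using degree_q_le[of n]
      by (intro arg_cong[where f = "(*) (u ^ ?N)"] sum.mono_neutral_right) (auto simp: coeff_eq_0)
    also have "\<dots> = poly ?R u"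
      using that by (simp add: poly_q poly_monom distrib_left mult_2 flip: power_add)
    finally show ?thesis .
  qed
  \<comment> \<open>The factor X makes both sides vanish at the excluded point 0; it is cancelled
    afterwards.\<close>
  then have "poly ([:0, 1:] * ?L) u = poly ([:0, 1:] * ?R) u" for u
    unfolding poly_mult by (cases "u = 0") simp_all
  then have "[:0, 1:] * ?L = [:0, 1:] * ?R"
    by (intro poly_eq_poly_eq_iff[THEN iffD1] ext)
  then show ?thesis
    unfolding mult_cancel_left by simp
qed

text \<open>Compares coefficients of u^j in \<open>q_homogenized\<close>; as j < 2 * 2^n, only the
  constant 1 on the right can contribute.\<close>

lemma sum_binomial_coeff_q:
  assumes "j \<le> 2 ^ n"
  shows "(\<Sum>i = 2 ^ n - j..2 ^ n. int (2 * i choose (j + i - 2 ^ n)) * coeff (q n) i)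
    = (if j = 0 then 1 else 0)"
proof -
  let ?N = "2 ^ n :: nat"
  have "real_of_int (\<Sum>i = ?N - j..?N. int (2 * i choose (j + i - ?N)) * coeff (q n) i)
      = (\<Sum>i = ?N - j..?N. real (2 * i choose (j + i - ?N)) * coeff (q n) i)"
    by (simp add: coeff_q_of_int[where 'a=real])
  \<comment> \<open>Terms with i < \<open>?N - j\<close> carry a power of u beyond u^j.\<close>
  also have "\<dots> = (\<Sum>i\<le>?N. if j < ?N - i then 0 else coeff (q n) i * real (2 * i choose (j - (?N - i))))"
  proof (rule sum.mono_neutral_cong_left)
    fix i assume "i \<in> {?N - j..?N}"
    then show "real (2 * i choose (j + i - ?N)) * coeff (q n) i
        = (if j < ?N - i then 0 else coeff (q n) i * real (2 * i choose (j - (?N - i))))"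
      by auto
  qed auto
  also have "\<dots> = coeff (\<Sum>i\<le>?N. monom (coeff (q n) i) (?N - i) * [:1, 1:] ^ (2 * i)) j"
    by (simp add: coeff_sum coeff_monom_mult coeff_one_plus_X_power cong: if_cong)
  also have "\<dots> = (if j = 0 then 1 else 0)"
    using assms by (simp add: q_homogenized coeff_1)
  also have "\<dots> = real_of_int (if j = 0 then 1 else 0)"
    by simp
  finally show ?thesis
    by (simp only: of_int_eq_iff)
qed

theorem theorem2p1:
  fixes n :: nat
  shows "c n (2 ^ (n + 1)) = 1 \<and>
    (\<forall>j\<in>{1..2 ^ n}.
      c n (2 * (2 ^ n - j)) =
        - (\<Sum>i = 2 ^ n - j + 1..2 ^ n. int ((2 * i) choose (j + i - 2 ^ n)) * c n (2 * i)))"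
proof (intro conjI ballI)
  show "c n (2 ^ (n + 1)) = 1"
    \<comment> \<open>For j = 0 only i = 2^n remains, with binomial 1.\<close>
    using sum_binomial_coeff_q[of 0 n] by (simp add: c_even)
next
  fix j :: nat assume j: "j \<in> {1..2 ^ n}"
  then have "(\<Sum>i = 2 ^ n - j..2 ^ n. int (2 * i choose (j + i - 2 ^ n)) * coeff (q n) i) = 0"
    using sum_binomial_coeff_q[of j n] by simp
  then show "c n (2 * (2 ^ n - j)) =
      - (\<Sum>i = 2 ^ n - j + 1..2 ^ n. int ((2 * i) choose (j + i - 2 ^ n)) * c n (2 * i))"
    \<comment> \<open>The split-off term i = 2^n - j has binomial coefficient (2i choose 0) =
      1.\<close>
    using j by (simp add: c_even sum.atLeast_Suc_atMost)
qed

end
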